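(* Let $p$ be an odd prime number and let $r$ be an integer with $1\le r\le p-1$. Then $$\sum_{k=1}^{p-r}\left\lfloor\frac{k^p}{p}\right\rfloor\equiv \frac{B_{p+1}(r)-B_{p+1}(0)}{p(p+1)}+\frac{(r-1-p)(p-r)}{2p}\pmod p .$$
   Context: $\lfloor x\rfloor$ denotes the floor (integer part) of $x$. $B_n(x)=\sum_{k=0}^n\binom{n}{k}B_k\,x^{n-k}$ is the $n$-th Bernoulli polynomial, where $B_k$ are the Bernoulli numbers (with $B_1=-1/2$), so $B_n(0)=B_n$. For rational numbers $a,b$, the congruence $a\equiv b\pmod p$ means that $a-b$ is an integer multiple of $p$. The fractions on the right-hand side are ordinary rational numbers. *)

theory Defs
  imports Complex_Main "HOL-Computational_Algebra.Primes"
begin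

text \<open>
  Bernoulli numbers with the convention $B_1 = -1/2$, by the usual recurrence
  $\sum_{k=0}^{n} \binom{n+1}{k} B_k = 0$ for $n \ge 1$, solved for $B_n$.
\<close>

context
  notes sum.cong [fundef_cong]
begin

fun bernoulli :: "nat \<Rightarrow> rat" where
  "bernoulli n =
     (if n = 0 then 1
      else - (\<Sum>k<n. of_nat (Suc n choose k) * bernoulli k) / of_nat (Suc n))"

end

declare bernoulli.simps [simp del]

lemma bernoulli_0 [simp]: "bernoulli 0 = 1"
  by (simp add: bernoulli.simps)

lemma bernoulli_rec:
  "n > 0 \<Longrightarrow> bernoulli n = - (\<Sum>k<n. of_nat (Suc n choose k) * bernoulli k) / of_nat (Suc n)"
  by (subst bernoulli.simps) simp

lemma sum_choose_bernoulli:
  "n > 0 \<Longrightarrow> (\<Sum>k\<le>n. of_nat (Suc n choose k) * bernoulli k) = 0"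
  by (simp add: bernoulli_rec[of n] lessThan_Suc_atMost[symmetric] del: of_nat_Suc)

lemma bernoulli_1: "bernoulli 1 = - 1 / 2"
  by (simp add: bernoulli_rec)

lemma bernoulli_2: "bernoulli 2 = 1 / 6"
  by (simp add: bernoulli_rec bernoulli_1[simplified] eval_nat_numeral)

definition bernpoly :: "nat \<Rightarrow> rat \<Rightarrow> rat" where
  "bernpoly n x = (\<Sum>k\<le>n. of_nat (n choose k) * bernoulli k * x ^ (n - k))"

lemma bernpoly_at_0: "bernpoly n 0 = bernoulli n"
  by (simp add: bernpoly_def power_0_left sum.remove[of _ n])

text \<open>
  The difference must be an integer multiple of the modulus.  This is not
  congruence over the ring of $p$-integral rationals, and \<open>cong\<close> on the
  field of rationals would not express it.
\<close>

definition rat_cong :: "rat \<Rightarrow> rat \<Rightarrow> int \<Rightarrow> bool" where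
  "rat_cong a b m \<longleftrightarrow> (\<exists>z::int. a - b = of_int z * of_int m)"

end

theory Submission
  imports Defs "HOL-Number_Theory.Residues"
begin

text \<open>
  Fermat's little theorem gives $\lfloor k^p/p\rfloor = (k^p-k)/p$ for $1 \le k < p$, and
  $(B_{p+1}(r)-B_{p+1}(0))/(p+1) = \sum_{k<r} k^p$.  The linear parts cancel exactly, so the claim
  becomes $\sum_{k=1}^{p-r} k^p \equiv \sum_{k<r} k^p \pmod{p^2}$.  Since
  $(p-k)^p \equiv -k^p \pmod{p^2}$, reflecting the left sum turns the difference of the two sides
  into $-\sum_{k<p} k^p$, and the same reflection shows that twice this sum vanishes.
\<close>

text \<open>Both sides count ordered pairs of disjoint subsets of sizes k and j in an n-set. They
  vanish when j + k > n, so the identity can be used on the whole square of indices.\<close>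

lemma choose_mult_swap:
  fixes n j k :: nat
  assumes "k \<le> n" "j \<le> n"
  shows "(n choose k) * ((n - k) choose j) = (n choose j) * ((n - j) choose k)"
proof (cases "j + k \<le> n")
  case True
  have "(n choose (n - j)) * ((n - j) choose k) = (n choose k) * ((n - k) choose (n - j - k))"
    using True by (intro choose_mult) auto
  moreover have "(n - k) choose (n - j - k) = (n - k) choose j"
    using True binomial_symmetric[of j "n - k"] by (simp add: add.commute)
  moreover have "n choose (n - j) = n choose j"
    using assms binomial_symmetric[of j n] by simp
  ultimately show ?thesis by simp
next
  case False
  then have "n - k < j" "n - j < k" using assms by linarith+
  then show ?thesis by (simp add: binomial_eq_0)
qed

text \<open>The recurrence kills all terms below the top one when m > 1. At m = 1 the sum is 1 - 1/2
  = B_1 + 1; this exception is the source of the power of x in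
  \<open>bernpoly_plus1\<close>.\<close>

lemma sum_choose_bernoulli_full:
  "(\<Sum>k\<le>m. of_nat (m choose k) * bernoulli k) = bernoulli m + (if m = 1 then 1 else 0)"
proof (cases "m \<le> 1")
  case True
  then consider "m = 0" | "m = 1" by linarith
  then show ?thesis by cases auto
next
  case False
  then obtain n where n: "m = Suc n" "n > 0" by (cases m) auto
  have "(\<Sum>k\<le>Suc n. of_nat (Suc n choose k) * bernoulli k) = bernoulli (Suc n)"
    unfolding sum.atMost_Suc using sum_choose_bernoulli[OF n(2)] by simp
  then show ?thesis using n by simp
qed

text \<open>Expand (x + 1)^(n - k) and collect powers of x. By \<open>choose_mult_swap\<close> the
  coefficient of x^j is (n choose j) times the full Bernoulli sum of index n - j, which is B_(n-j)
  except for an extra 1 at j = n - 1.\<close>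

lemma bernpoly_plus1:
  assumes "n > 0"
  shows "bernpoly n (x + 1) = bernpoly n x + of_nat n * x ^ (n - 1)"
proof -
  have "bernpoly n (x + 1) =
      (\<Sum>k\<le>n. \<Sum>j\<le>n. of_nat ((n choose k) * ((n - k) choose j)) * bernoulli k * x ^ j)"
    unfolding bernpoly_def
  proof (rule sum.cong[OF refl])
    fix k
    have "(x + 1) ^ (n - k) = (\<Sum>j\<le>n - k. of_nat ((n - k) choose j) * x ^ j)"
      by (simp add: binomial_ring)
    \<comment> \<open>Padding with vanishing binomials makes the range of j independent of k, so the
      two sums can be interchanged.\<close>
    also have "\<dots> = (\<Sum>j\<le>n. of_nat ((n - k) choose j) * x ^ j)"
      by (intro sum.mono_neutral_left) (auto simp: binomial_eq_0)
    finally show "of_nat (n choose k) * bernoulli k * (x + 1) ^ (n - k) =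
        (\<Sum>j\<le>n. of_nat ((n choose k) * ((n - k) choose j)) * bernoulli k * x ^ j)"
      by (simp add: sum_distrib_left mult_ac)
  qed
  also have "\<dots> = (\<Sum>j\<le>n. \<Sum>k\<le>n. of_nat ((n choose k) * ((n - k) choose j)) * bernoulli k * x ^ j)"
    by (rule sum.swap)
  also have "\<dots> = (\<Sum>j\<le>n. of_nat (n choose j) * x ^ j *
      (bernoulli (n - j) + (if n - j = 1 then 1 else 0)))"
  proof (rule sum.cong[OF refl])
    fix j assume j: "j \<in> {..n}"
    have "(\<Sum>k\<le>n. of_nat ((n choose k) * ((n - k) choose j)) * bernoulli k * x ^ j) =
        (\<Sum>k\<le>n. of_nat ((n choose j) * ((n - j) choose k)) * bernoulli k * x ^ j)"
      using j by (intro sum.cong refl) (simp only: choose_mult_swap atMost_iff)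
    also have "\<dots> = of_nat (n choose j) * x ^ j * (\<Sum>k\<le>n. of_nat ((n - j) choose k) * bernoulli k)"
      by (simp add: sum_distrib_left mult_ac)
    also have "(\<Sum>k\<le>n. of_nat ((n - j) choose k) * bernoulli k) =
        (\<Sum>k\<le>n - j. of_nat ((n - j) choose k) * bernoulli k)"
      by (intro sum.mono_neutral_right) (auto simp: binomial_eq_0)
    finally show "(\<Sum>k\<le>n. of_nat ((n choose k) * ((n - k) choose j)) * bernoulli k * x ^ j) =
        of_nat (n choose j) * x ^ j * (bernoulli (n - j) + (if n - j = 1 then 1 else 0))"
      by (simp only: sum_choose_bernoulli_full)
  qed
  also have "\<dots> = (\<Sum>j\<le>n. of_nat (n choose j) * bernoulli (n - j) * x ^ j) +
      (\<Sum>j\<le>n. if j = n - 1 then of_nat (n choose j) * x ^ j else 0)"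
    unfolding sum.distrib[symmetric] using assms
    by (intro sum.cong refl) (auto simp: algebra_simps)
  also have "(\<Sum>j\<le>n. of_nat (n choose j) * bernoulli (n - j) * x ^ j) = bernpoly n x"
    unfolding bernpoly_def
    by (rule sum.reindex_bij_witness[of _ "\<lambda>k. n - k" "\<lambda>k. n - k"])
       (auto simp: binomial_symmetric[symmetric])
  also have "(\<Sum>j\<le>n. if j = n - 1 then of_nat (n choose j) * x ^ j else 0) = of_nat n * x ^ (n - 1)"
    using assms binomial_symmetric[of 1 n] by (simp add: sum.delta)
  finally show ?thesis .
qed

text \<open>Telescoping of \<open>bernpoly_plus1\<close> over x = 0, ..., r - 1.\<close>

lemma sum_powers_bernpoly:
  "bernpoly (Suc n) (of_nat r) - bernpoly (Suc n) 0 = of_nat (Suc n) * (\<Sum>k<r. of_nat k ^ n)"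
proof (induction r)
  case (Suc r)
  then show ?case
    using bernpoly_plus1[of "Suc n" "of_nat r"] by (simp add: algebra_simps)
qed simp

lemma floor_prime_power:
  fixes p k :: nat
  assumes "prime p" "k < p"
  shows "of_int \<lfloor>(of_nat (k ^ p) :: rat) / of_nat p\<rfloor> = (of_nat k ^ p - of_nat k) / (of_nat p :: rat)"
proof -
  have "[k ^ p = k] (mod p)"
  proof (cases "k = 0")
    case True
    then show ?thesis using assms by (simp add: power_0_left)
  next
    case False
    then have "\<not> p dvd k"
      using assms by (auto dest: dvd_imp_le)
    from cong_scalar_right[OF fermat_theorem[OF assms(1) this], of k] show ?thesis
      using assms(2) power_minus_mult[of p k] by simp
  qed
  \<comment> \<open>Here k < p makes k itself the remainder, so the floor is an exact
    quotient.\<close>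
  then have "k ^ p mod p = k"
    using assms(2) by (simp add: cong_def)
  then have "k ^ p = p * (k ^ p div p) + k"
    by (metis mult_div_mod_eq)
  from arg_cong[OF this, of "of_nat :: nat \<Rightarrow> rat"]
  have "(of_nat k ^ p - of_nat k) / (of_nat p :: rat) = of_nat (k ^ p div p)"
    using assms(2) by simp
  then show ?thesis
    by (simp only: floor_divide_of_nat_eq of_int_of_nat_eq)
qed

text \<open>For odd p the sum equals (p - k)^p - (-k)^p, which factors as p times \<open>?S\<close>.
  Modulo p, all p terms of \<open>?S\<close> agree with (-k)^(p-1), which yields a second factor
  p.\<close>

lemma square_dvd_power_sum_reflect:
  fixes k :: int and p :: nat
  assumes "odd p"
  shows "(int p)\<^sup>2 dvd (int p - k) ^ p + k ^ p"
proof -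
  let ?S = "\<Sum>i<p. (- k) ^ (p - Suc i) * (int p - k) ^ i"
  have "[?S = (\<Sum>i<p. (- k) ^ (p - Suc i) * (- k) ^ i)] (mod int p)"
    by (intro cong_sum cong_mult cong_refl cong_pow) (simp add: cong_iff_dvd_diff)
  also have "(\<Sum>i<p. (- k) ^ (p - Suc i) * (- k) ^ i) = (\<Sum>i<p. (- k) ^ (p - 1))"
    by (intro sum.cong refl) (simp flip: power_add)
  finally have "int p dvd ?S"
    by (simp add: cong_def mod_eq_0_iff_dvd)
  moreover have "(int p - k) ^ p + k ^ p = int p * ?S"
    using power_diff_sumr2[of "int p - k" p "- k"] assms by simp
  ultimately show ?thesis
    by (simp add: power2_eq_square)
qed

text \<open>Pairing k with p - k shows divisibility for twice the sum; the 2 cancels because p^2 is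
  odd.\<close>

lemma square_dvd_sum_powers:
  fixes p :: nat
  assumes "odd p"
  shows "(int p)\<^sup>2 dvd (\<Sum>k\<in>{1..<p}. int k ^ p)"
proof -
  have "(\<Sum>k\<in>{1..<p}. int k ^ p) = (\<Sum>k\<in>{1..<p}. (int p - int k) ^ p)"
    by (rule sum.reindex_bij_witness[of _ "\<lambda>k. p - k" "\<lambda>k. p - k"]) auto
  then have "2 * (\<Sum>k\<in>{1..<p}. int k ^ p) = (\<Sum>k\<in>{1..<p}. (int p - int k) ^ p + int k ^ p)"
    by (simp add: sum.distrib)
  then have "(int p)\<^sup>2 dvd 2 * (\<Sum>k\<in>{1..<p}. int k ^ p)"
    using square_dvd_power_sum_reflect[OF assms] by (simp add: dvd_sum)
  moreover have "coprime ((int p)\<^sup>2) 2"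
    using assms by simp
  ultimately show ?thesis
    by (simp add: coprime_dvd_mult_right_iff)
qed

text \<open>The reflection carries 1..p - r onto r..p - 1, the complement of 1..r - 1. Subtracting
  the sum over k < r thus amounts to adding k^p to each reflected term and subtracting the full
  power sum.\<close>

lemma square_dvd_sum_powers_diff:
  fixes p r :: nat
  assumes "odd p" "1 \<le> r" "r \<le> p"
  shows "(int p)\<^sup>2 dvd (\<Sum>k=1..p - r. int k ^ p) - (\<Sum>k<r. int k ^ p)"
proof -
  have "(\<Sum>k=1..p - r. int k ^ p) = (\<Sum>k\<in>{r..<p}. (int p - int k) ^ p)"
    using assms by (intro sum.reindex_bij_witness[of _ "\<lambda>k. p - k" "\<lambda>k. p - k"]) auto
  \<comment> \<open>The term k = 0 drops out because p > 0.\<close>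
  moreover have "(\<Sum>k<r. int k ^ p) = (\<Sum>k\<in>{1..<r}. int k ^ p)"
    using assms by (intro sum.mono_neutral_right) (auto simp: odd_pos)
  moreover have "(\<Sum>k\<in>{1..<p}. int k ^ p) = (\<Sum>k\<in>{1..<r}. int k ^ p) + (\<Sum>k\<in>{r..<p}. int k ^ p)"
    using assms by (simp add: sum.atLeastLessThan_concat)
  ultimately have "(\<Sum>k=1..p - r. int k ^ p) - (\<Sum>k<r. int k ^ p) =
      (\<Sum>k\<in>{r..<p}. (int p - int k) ^ p + int k ^ p) - (\<Sum>k\<in>{1..<p}. int k ^ p)"
    by (simp add: sum.distrib)
  then show ?thesis
    using square_dvd_power_sum_reflect[OF assms(1)] square_dvd_sum_powers[OF assms(1)]
    by (simp add: dvd_sum)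
qed

theorem theorem1:
  fixes p r :: nat
  assumes "prime p" and "odd p"
    and "1 \<le> r" and "r \<le> p - 1"
  shows "rat_cong
    (\<Sum>k = 1..p - r. of_int \<lfloor>(of_nat (k ^ p) :: rat) / of_nat p\<rfloor>)
    ((bernpoly (p + 1) (of_nat r) - bernpoly (p + 1) 0) / (of_nat p * (of_nat p + 1))
       + (of_nat r - 1 - of_nat p) * (of_nat p - of_nat r) / (2 * of_nat p))
    (int p)"
proof -
  have p: "p > 0" using assms(1) by (simp add: prime_gt_0_nat)
  let ?P = "of_nat p :: rat" and ?R = "of_nat r :: rat"
  let ?A = "\<Sum>k=1..p - r. (of_nat k :: rat) ^ p" and ?B = "\<Sum>k<r. (of_nat k :: rat) ^ p"
  have "r \<le> p" using assms by simp
  from square_dvd_sum_powers_diff[OF assms(2,3) this]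
  obtain z where "(\<Sum>k=1..p - r. int k ^ p) - (\<Sum>k<r. int k ^ p) = (int p)\<^sup>2 * z"
    by (rule dvdE)
  from arg_cong[OF this, of "of_int :: int \<Rightarrow> rat"] have z: "?A - ?B = ?P\<^sup>2 * of_int z"
    by simp
  have gauss: "(\<Sum>k=1..p - r. (of_nat k :: rat)) = (?P - ?R) * (?P - ?R + 1) / 2"
    using double_gauss_sum_from_Suc_0[of "p - r", where 'a = rat] assms by (simp add: of_nat_diff)
  have "(\<Sum>k = 1..p - r. of_int \<lfloor>(of_nat (k ^ p) :: rat) / ?P\<rfloor>) =
      (\<Sum>k = 1..p - r. (of_nat k ^ p - of_nat k) / ?P)"
    using assms p by (intro sum.cong refl floor_prime_power) auto
  also have "\<dots> = (?A - (?P - ?R) * (?P - ?R + 1) / 2) / ?P"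
    by (simp only: gauss sum_subtractf flip: sum_divide_distrib)
  finally have lhs: "(\<Sum>k = 1..p - r. of_int \<lfloor>(of_nat (k ^ p) :: rat) / ?P\<rfloor>) =
      (?A - (?P - ?R) * (?P - ?R + 1) / 2) / ?P" .
  have "?P + 1 \<noteq> 0"
    by (metis of_nat_Suc add.commute of_nat_eq_0_iff nat.distinct(1))
  then have rhs: "(bernpoly (p + 1) ?R - bernpoly (p + 1) 0) / (?P * (?P + 1)) = ?B / ?P"
    using sum_powers_bernpoly[of p r] by (simp add: add.commute)
  \<comment> \<open>The Gauss sum term is literally the second summand on the right, since R - 1 - P
    = -(P - R + 1). What remains is p^2 z / p, so z is the required witness.\<close>
  have "(?A - (?P - ?R) * (?P - ?R + 1) / 2) / ?P -
      (?B / ?P + (?R - 1 - ?P) * (?P - ?R) / (2 * ?P)) = (?A - ?B) / ?P"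
    using p by (simp add: field_simps)
  also have "\<dots> = of_int z * of_int (int p)"
    using p unfolding z by (simp add: power2_eq_square)
  finally show ?thesis
    unfolding rat_cong_def lhs rhs by blast
qed

end
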